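(* Consider the optimization problem in the decision variables $\overline{U}\in\mathbb{R}^{Nn_u}$, $\mathbf{K}\in\mathcal{K}$ and $\zeta=[\zeta_0,\dots,\zeta_N]^\top\in\mathbb{R}^{N+1}$: minimize $$J_{\mathrm{penalty}}(\overline{U},\mathbf{K},\zeta)=J_{\mathrm{ub}}(\overline{U},\mathbf{K})+w\|\zeta\|_1,$$ where $J_{\mathrm{ub}}(\overline{U},\mathbf{K})=\sum_{k=0}^{N-1}\big[\|\overline{u}_k\|_2+m_{\chi^2}(0.01,n_u)\,\|P_{u_k}^{1/2}\|_2\big]$ (impulsive control), or $J_{\mathrm{ub}}(\overline{U},\mathbf{K})=\sum_{k=0}^{N-1}\big[\|\overline{u}_k\|_2+m_{\chi^2}(0.01,n_u)\,\|P_{u_k}^{1/2}\|_2\big]\Delta t_k$ (continuous control), subject to (i) $a_j^\top\overline{x}_k+b_j+m_{\mathcal N}(\varepsilon_{x,j})\,\|a_j^\top P_k^{1/2}\|_2\le 0$ for all $j$ and all $k\in\{0,\dots,N\}$; (ii) $\|H(\overline{x}_k-x_k^* )\|_2+m_{\chi^2}(\varepsilon_x,n_h)\,\|HP_k^{1/2}\|_2\le d_{\max}$ for all $k\in\{0,\dots,N\}$; (iii) $\|\overline{u}_k\|_2+m_{\chi^2}(\varepsilon_u,n_u)\,\|P_{u_k}^{1/2}\|_2\le u_{\max}$ for all $k\in\{0,\dots,N-1\}$; (iv) $\|(E_{u_{k+1}}-E_{u_k})\overline{U}\|_2+m_{\chi^2}(\varepsilon_u,n_u)\,\|(E_{u_{k+1}}-E_{u_k})\mathbf{K}\mathbf{S}^{1/2}\|_2\le\Delta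 u_{\max}$ for all $k\in\{0,\dots,N-2\}$; (v) $E_{x_N}(\mathbf{A}\overline{x}_0+\mathbf{B}\overline{U}+\mathbf{C})-x_f=0$; (vi) $\|(P_f-\widetilde{P}_N)^{-1/2}E_{x_N}(I+\mathbf{B}\mathbf{K})\mathbf{S}^{1/2}\|_2-1\le 0$; (vii) $-\min\{g_{\mathrm{stc}}(\overline{x}_k^* ),0\}\cdot c_{\mathrm{stc}}(\overline{x}_k,P_k^{1/2})\le\zeta_k$ for all $k\in\{0,\dots,N\}$, where $g_{\mathrm{stc}}(x)=\|H_rx\|_2-r_{\mathrm{trigger}}$ and $$c_{\mathrm{stc}}(\overline{x}_k,P_k^{1/2})=\|A_{\mathrm{cone}}H_r\overline{x}_k\|_2-b_{\mathrm{cone}}^\top H_r\overline{x}_k+m_{\chi^2}\!\left(\tfrac{\varepsilon_x}{2},2\right)\|A_{\mathrm{cone}}H_rP_k^{1/2}\|_2+m_{\mathcal N}\!\left(\tfrac{\varepsilon_x}{2}\right)\|b_{\mathrm{cone}}^\top H_rP_k^{1/2}\|_2 .$$ Here $\overline{u}_k=E_{u_k}\overline{U}$, $\overline{x}_k=E_{x_k}(\mathbf{A}\overline{x}_0+\mathbf{B}\overline{U}+\mathbf{C})$, $P_k^{1/2}=\big[\,E_{x_k}(I+\mathbf{B}\mathbf{K})\mathbf{S}^{1/2}\;\;\widetilde{P}_k^{1/2}\,\big]$, $P_{u_k}^{1/2}=E_{u_k}\mathbf{K}\mathbf{S}^{1/2}$, and the $\overline{x}_k^*\in\mathbb{R}^{n_x}$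 are fixed reference mean states (not decision variables). Then this problem is a convex optimization problem.
   Context: "Convex optimization problem" means: minimize a convex function of the decision variables over a set given by finitely many inequalities (convex function) $\le 0$ and affine equalities. For a vector $\|\cdot\|_p$ is the $l_p$ norm; for a matrix $\|\cdot\|_2$ is the spectral norm. Fixed data: integers $N,n_x,n_u,n_y,n_h\ge 1$; matrices $A_k\in\mathbb{R}^{n_x\times n_x}$, $B_k\in\mathbb{R}^{n_x\times n_u}$, $G_{\mathrm{exe},k}$, $G_k$ (with $n_x$ rows) and vectors $c_k\in\mathbb{R}^{n_x}$ for $k=0,\dots,N-1$; matrices $C_k\in\mathbb{R}^{n_y\times n_x}$, $D_k\in\mathbb{R}^{n_y\times n_y}$ for $k=0,\dots,N$; $\overline{x}_0\in\mathbb{R}^{n_x}$; positive semidefinite $\hat P_{0^-},\widetilde P_0^-\in\mathbb{R}^{n_x\times n_x}$. Kalman filter quantities are computed a priori by $P_{\widetilde y_k^-}=C_k\widetilde P_k^-C_k^\top+D_kD_k^\top$ (assumed invertible), $L_k=\widetilde P_k^-C_k^\top P_{\widetilde y_k^-}^{-1}$, $\widetilde P_k=(I-L_kC_k)\widetilde P_k^-(I-L_kC_k)^\top+L_kD_kD_k^\top L_k^\top$ for $k=0,\dots,N$, and $\widetilde P_{k}^-=A_{k-1}\widetilde P_{k-1}A_{k-1}^\top+G_{\mathrm{exe},k-1}G_{\mathrm{exe},k-1}^\top+G_{k-1}G_{k-1}^\top$ for $k\ge1$. For a positive semidefinite $M$, $M^{1/2}$ denotes a lower-triangular matrix with $M=M^{1/2}(M^{1/2})^\top$,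 and $M^{-1/2}=(M^{1/2})^{-1}$ if $M\succ0$. With $\Phi(k,j)=A_{k-1}A_{k-2}\cdots A_j$ for $k>j$ and $\Phi(j,j)=I$, define block matrices with block rows $k=0,\dots,N$: $\mathbf A$ has block rows $\Phi(k,0)$; $\mathbf B$ has blocks $(k,j)$, $j=0,\dots,N-1$, equal to $\Phi(k,j+1)B_j$ if $j<k$ and $0$ otherwise; $\mathbf C$ has block rows $\sum_{j<k}\Phi(k,j+1)c_j$; $\mathbf L$ has blocks $(k,j)$, $j=0,\dots,N$, equal to $\Phi(k,j)L_j$ if $j\le k$ and $0$ otherwise. Let $\mathbf P_Y=\mathrm{blkdiag}(P_{\widetilde y_0^-},\dots,P_{\widetilde y_N^-})$ and $\mathbf S^{1/2}=\big[\mathbf A\hat P_{0^-}^{1/2}\;\;\mathbf L\mathbf P_Y^{1/2}\big]$ (so $\mathbf S^{1/2}(\mathbf S^{1/2})^\top=\mathbf S:=\mathbf A\hat P_{0^-}\mathbf A^\top+\mathbf L\mathbf P_Y\mathbf L^\top$). $E_{x_k}$ ($k=0,\dots,N$) extracts the $k$-th $n_x$-block from a vector in $\mathbb{R}^{(N+1)n_x}$; $E_{u_k}$ ($k=0,\dots,N-1$) extracts the $k$-th $n_u$-block from a vector in $\mathbb{R}^{Nn_u}$. $\mathcal K$ is the linear space of matrices $\mathbf K\in\mathbb{R}^{Nn_u\times(N+1)n_x}$ of the form $\mathbf K=[\mathrm{blkdiag}(K_0,\dots,K_{N-1})\;\;0]$ with $K_k\in\mathbb{R}^{n_u\times n_x}$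 (last block column zero). $m_{\mathcal N}(\varepsilon)$ is the $(1-\varepsilon)$-quantile of the standard normal distribution; $m_{\chi^2}(\varepsilon,n)$ is the square root of the $(1-\varepsilon)$-quantile of the chi-squared distribution with $n$ degrees of freedom. Constraint data: finitely many $a_j\in\mathbb{R}^{n_x}$, $b_j\in\mathbb{R}$; $\varepsilon_x\in(0,0.5)$, $\varepsilon_u\in(0,1)$; fixed $\varepsilon_{x,j}>0$ with $\sum_j\varepsilon_{x,j}\le\varepsilon_x$; $H\in\mathbb{R}^{n_h\times n_x}$; reference states $x_k^*\in\mathbb{R}^{n_x}$; $d_{\max},u_{\max},\Delta u_{\max}>0$; $\Delta t_k>0$; $x_f\in\mathbb{R}^{n_x}$; $P_f\in\mathbb{R}^{n_x\times n_x}$ symmetric with $P_f-\widetilde P_N\succ0$; $H_r\in\mathbb{R}^{3\times n_x}$ (extracts position from the state), $A_{\mathrm{cone}}\in\mathbb{R}^{2\times3}$, $b_{\mathrm{cone}}\in\mathbb{R}^3$, $r_{\mathrm{trigger}}>0$; penalty weight $w>0$. *)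

theory Defs
  imports "HOL-Probability.Probability"
begin

text \<open>
  A problem asks to minimize \<open>objective v\<close> over all \<open>v\<close> in the linear space \<open>space_of\<close> of
  decision variables such that \<open>g v \<le> 0\<close> for all \<open>g \<in> ineqs\<close> and \<open>h v = 0\<close> for all
  \<open>h \<in> eqs\<close>.  An equality constraint may be vector-valued.
\<close>

record ('v, 'e) opt_problem =
  space_of :: "'v set"
  objective :: "'v \<Rightarrow> real"
  ineqs :: "('v \<Rightarrow> real) set"
  eqs :: "('v \<Rightarrow> 'e) set"

definition affine_map_on :: "'v::real_vector set \<Rightarrow> ('v \<Rightarrow> 'e::real_vector) \<Rightarrow> bool" where
  "affine_map_on X h \<longleftrightarrow> (\<exists>l c. linear l \<and> (\<forall>v\<in>X. h v = l v + c))"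

definition convex_optimization_problem ::
    "('v::real_vector, 'e::real_vector) opt_problem \<Rightarrow> bool" where
  "convex_optimization_problem p \<longleftrightarrow>
     subspace (space_of p) \<and>
     convex_on (space_of p) (objective p) \<and>
     finite (ineqs p) \<and> (\<forall>g\<in>ineqs p. convex_on (space_of p) g) \<and>
     finite (eqs p) \<and> (\<forall>h\<in>eqs p. affine_map_on (space_of p) h)"

text \<open>
  The function \<open>norm\<close> on the type \<open>real^'n^'m\<close> is the Frobenius norm; the spectral norm is the
  operator norm induced by the Euclidean norms.
\<close>

definition spectral_norm :: "real^'n^'m \<Rightarrow> real" where
  "spectral_norm M = onorm (\<lambda>v. M *v v)"

definition psd :: "real^'n^'n \<Rightarrow> bool" where
  "psd M \<longleftrightarrow> transpose M = M \<and> (\<forall>v. 0 \<le> v \<bullet> (M *v v))"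

definition pos_def :: "real^'n^'n \<Rightarrow> bool" where
  "pos_def M \<longleftrightarrow> transpose M = M \<and> (\<forall>v. v \<noteq> 0 \<longrightarrow> 0 < v \<bullet> (M *v v))"

text \<open>
  \<open>R\<close> is an admissible choice of \<open>M\<^sup>1\<^sup>/\<^sup>2\<close>, where \<open>before\<close> is the order in which the rows and columns
  are enumerated.  The order is a parameter because the library orders pairs componentwise,
  whereas block matrices (indexed by pairs of a block and a position inside the block) are
  enumerated lexicographically.
\<close>

definition lower_triangular_sqrt ::
    "('n \<Rightarrow> 'n \<Rightarrow> bool) \<Rightarrow> real^'n^'n \<Rightarrow> real^'n^'n \<Rightarrow> bool" where
  "lower_triangular_sqrt before M R \<longleftrightarrow>
     (\<forall>i j. before i j \<longrightarrow> R $ i $ j = 0) \<and> M = R ** transpose R"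

definition lex_less :: "'a::linorder \<times> 'b::linorder \<Rightarrow> 'a \<times> 'b \<Rightarrow> bool" where
  "lex_less p q \<longleftrightarrow> fst p < fst q \<or> fst p = fst q \<and> snd p < snd q"

text \<open>The matrix \<open>[M\<^sub>1 M\<^sub>2]\<close>.\<close>

definition hcat :: "real^'a^'m \<Rightarrow> real^'b^'m \<Rightarrow> real^('a + 'b)^'m" where
  "hcat M1 M2 = (\<chi> i q. case q of Inl a \<Rightarrow> M1 $ i $ a | Inr b \<Rightarrow> M2 $ i $ b)"

text \<open>
  Blocks are indexed by finite linearly ordered types; \<open>blk k\<close> is the number of the block \<open>k\<close>,
  so that the numbers run from \<open>0\<close> to the cardinality of the type minus one.
\<close>

definition blk :: "'i::{finite,linorder} \<Rightarrow> nat" where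
  "blk k = card {j. j < k}"

lemma bij_betw_blk: "bij_betw (blk :: 'i::{finite,linorder} \<Rightarrow> nat) UNIV {..<CARD('i)}"
proof -
  have lt: "blk k < blk l" if "k < l" for k l :: 'i
    unfolding blk_def using that by (intro psubset_card_mono) (auto intro: less_trans)
  have inj: "inj (blk :: 'i \<Rightarrow> nat)"
    by (rule injI) (metis lt less_irrefl not_less_iff_gr_or_eq)
  have "range (blk :: 'i \<Rightarrow> nat) \<subseteq> {..<CARD('i)}"
    unfolding blk_def by (auto intro!: psubset_card_mono)
  moreover have "card (range (blk :: 'i \<Rightarrow> nat)) = CARD('i)"
    by (rule card_image[OF inj])
  ultimately have "range (blk :: 'i \<Rightarrow> nat) = {..<CARD('i)}"
    by (intro card_subset_eq) auto
  with inj show ?thesis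
    by (simp add: bij_betw_def)
qed

text \<open>The block matrix with blocks \<open>F k j\<close>.\<close>

definition block_mat ::
    "(nat \<Rightarrow> nat \<Rightarrow> real^'b^'a) \<Rightarrow>
     real^('n::{finite,linorder} \<times> 'b)^('m::{finite,linorder} \<times> 'a)" where
  "block_mat F = (\<chi> p q. F (blk (fst p)) (blk (fst q)) $ snd p $ snd q)"

text \<open>
  Vertical stacking of \<open>F 0, F 1, \<dots>\<close>: of vectors if \<open>'e\<close> is \<open>real\<close>, of matrices if \<open>'e\<close> is a
  type of row vectors.
\<close>

definition stack :: "(nat \<Rightarrow> 'e^'a) \<Rightarrow> 'e^('m::{finite,linorder} \<times> 'a)" where
  "stack F = (\<chi> p. F (blk (fst p)) $ snd p)"

definition blkdiag ::
    "(nat \<Rightarrow> real^'b^'a) \<Rightarrow>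
     real^('n::{finite,linorder} \<times> 'b)^('m::{finite,linorder} \<times> 'a)" where
  "blkdiag F = block_mat (\<lambda>k j. if k = j then F k else 0)"

text \<open>The matrix that extracts the \<open>k\<close>-th block of a stacked vector.\<close>

definition block_of :: "nat \<Rightarrow> real^('m::{finite,linorder} \<times> 'a)^'a" where
  "block_of k = (\<chi> i q. if blk (fst q) = k \<and> snd q = i then 1 else 0)"

definition quantile :: "real measure \<Rightarrow> real \<Rightarrow> real" where
  "quantile M p = Inf {x. p \<le> cdf M x}"

text \<open>The law of the sum of the squares of \<open>n\<close> independent standard normal variables.\<close>

definition chi_squared :: "nat \<Rightarrow> real measure" where
  "chi_squared n =
     distr (Pi\<^sub>M {..<n} (\<lambda>_. std_normal_distribution)) borel (\<lambda>x. \<Sum>i<n. (x i)\<^sup>2)"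

definition m_normal :: "real \<Rightarrow> real" where
  "m_normal \<epsilon> = quantile std_normal_distribution (1 - \<epsilon>)"

definition m_chi2 :: "real \<Rightarrow> nat \<Rightarrow> real" where
  "m_chi2 \<epsilon> n = sqrt (quantile (chi_squared n) (1 - \<epsilon>))"

text \<open>
  The dimensions \<open>n\<^sub>x, n\<^sub>u, n\<^sub>y, n\<^sub>h\<close> are the cardinalities of \<open>'x, 'u, 'y, 'h\<close>; the types
  \<open>'d\<close> and \<open>'g\<close> index the columns of \<open>G\<^sub>e\<^sub>x\<^sub>e\<close> and \<open>G\<close>, and \<open>'m\<close> (of cardinality \<open>N + 1\<close>)
  indexes the times \<open>0, \<dots>, N\<close>.  Data depending on the time or on a constraint number are functions
  on \<open>nat\<close>, of which only the values at the relevant arguments are used.  The states \<open>x_ref\<close>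
  are the centres of the ball constraint, the states \<open>xbar_ref\<close> (the mean states of a reference
  solution) only enter through the trigger function \<open>g_stc\<close>.  The last four fields
  hold the chosen square roots of \<open>P0_hat\<close>, of the filtered covariances, of the block diagonal
  matrix of the innovation covariances and of the difference between \<open>P_f\<close> and the final
  filtered covariance.
\<close>

record ('x, 'u, 'y, 'h, 'd, 'g, 'm) steering_data =
  horizon :: nat
  dyn_A :: "nat \<Rightarrow> real^'x^'x"
  dyn_B :: "nat \<Rightarrow> real^'u^'x"
  dyn_c :: "nat \<Rightarrow> real^'x"
  noise_Gexe :: "nat \<Rightarrow> real^'d^'x"
  noise_G :: "nat \<Rightarrow> real^'g^'x"
  obs_C :: "nat \<Rightarrow> real^'x^'y"
  obs_D :: "nat \<Rightarrow> real^'y^'y"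
  x0_bar :: "real^'x"
  P0_hat :: "real^'x^'x"
  P0_tilde_minus :: "real^'x^'x"
  n_con :: nat
  con_a :: "nat \<Rightarrow> real^'x"
  con_b :: "nat \<Rightarrow> real"
  eps_con :: "nat \<Rightarrow> real"
  eps_x :: real
  eps_u :: real
  mat_H :: "real^'x^'h"
  x_ref :: "nat \<Rightarrow> real^'x"
  d_max :: real
  u_max :: real
  du_max :: real
  dt :: "nat \<Rightarrow> real"
  x_f :: "real^'x"
  P_f :: "real^'x^'x"
  H_r :: "real^'x^3"
  A_cone :: "real^3^2"
  b_cone :: "real^3"
  r_trigger :: real
  xbar_ref :: "nat \<Rightarrow> real^'x"
  weight :: real
  P0_hat_half :: "real^'x^'x"
  P_tilde_half :: "nat \<Rightarrow> real^'x^'x"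
  P_Y_half :: "real^('m \<times> 'y)^('m \<times> 'y)"
  P_gap_half :: "real^'x^'x"

text \<open>Kalman filter; the argument \<open>P\<close> stands for the predicted covariance.\<close>

definition innov_cov :: "real^'x^'y \<Rightarrow> real^'y^'y \<Rightarrow> real^'x^'x \<Rightarrow> real^'y^'y" where
  "innov_cov C D P = C ** P ** transpose C + D ** transpose D"

definition kalman_gain :: "real^'x^'y \<Rightarrow> real^'y^'y \<Rightarrow> real^'x^'x \<Rightarrow> real^'y^'x" where
  "kalman_gain C D P = P ** transpose C ** matrix_inv (innov_cov C D P)"

definition kalman_update :: "real^'x^'y \<Rightarrow> real^'y^'y \<Rightarrow> real^'x^'x \<Rightarrow> real^'x^'x" where
  "kalman_update C D P =
     (let L = kalman_gain C D P in
      (mat 1 - L ** C) ** P ** transpose (mat 1 - L ** C)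
        + L ** D ** transpose D ** transpose L)"

primrec P_tilde_minus ::
    "('x::finite, 'u::finite, 'y::finite, 'h::finite, 'd::finite, 'g::finite,
      'm::finite) steering_data \<Rightarrow> nat \<Rightarrow> real^'x^'x" where
  "P_tilde_minus s 0 = P0_tilde_minus s"
| "P_tilde_minus s (Suc k) =
     dyn_A s k ** kalman_update (obs_C s k) (obs_D s k) (P_tilde_minus s k) ** transpose (dyn_A s k)
       + noise_Gexe s k ** transpose (noise_Gexe s k)
       + noise_G s k ** transpose (noise_G s k)"

definition P_tilde ::
    "('x::finite, 'u::finite, 'y::finite, 'h::finite, 'd::finite, 'g::finite,
      'm::finite) steering_data \<Rightarrow> nat \<Rightarrow> real^'x^'x" where
  "P_tilde s k = kalman_update (obs_C s k) (obs_D s k) (P_tilde_minus s k)"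

definition P_innov ::
    "('x::finite, 'u::finite, 'y::finite, 'h::finite, 'd::finite, 'g::finite,
      'm::finite) steering_data \<Rightarrow> nat \<Rightarrow> real^'y^'y" where
  "P_innov s k = innov_cov (obs_C s k) (obs_D s k) (P_tilde_minus s k)"

definition gain_L ::
    "('x::finite, 'u::finite, 'y::finite, 'h::finite, 'd::finite, 'g::finite,
      'm::finite) steering_data \<Rightarrow> nat \<Rightarrow> real^'y^'x" where
  "gain_L s k = kalman_gain (obs_C s k) (obs_D s k) (P_tilde_minus s k)"

definition P_Y ::
    "('x::finite, 'u::finite, 'y::finite, 'h::finite, 'd::finite, 'g::finite,
      'm::{finite,linorder}) steering_data \<Rightarrow>
     real^('m \<times> 'y)^('m \<times> 'y)" where
  "P_Y s = blkdiag (P_innov s)"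

text \<open>Transition matrices; the values for \<open>k < j\<close> are irrelevant.\<close>

primrec trans_Phi ::
    "('x::finite, 'u::finite, 'y::finite, 'h::finite, 'd::finite, 'g::finite,
      'm::finite) steering_data \<Rightarrow> nat \<Rightarrow> nat \<Rightarrow> real^'x^'x" where
  "trans_Phi s 0 j = mat 1"
| "trans_Phi s (Suc k) j = (if Suc k \<le> j then mat 1 else dyn_A s k ** trans_Phi s k j)"

definition big_A ::
    "('x::finite, 'u::finite, 'y::finite, 'h::finite, 'd::finite, 'g::finite,
      'm::{finite,linorder}) steering_data \<Rightarrow> real^'x^('m \<times> 'x)" where
  "big_A s = stack (\<lambda>k. trans_Phi s k 0)"

definition big_B ::
    "('x::finite, 'u::finite, 'y::finite, 'h::finite, 'd::finite, 'g::finite,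
      'm::{finite,linorder}) steering_data \<Rightarrow>
     real^('n::{finite,linorder} \<times> 'u)^('m \<times> 'x)" where
  "big_B s = block_mat (\<lambda>k j. if j < k then trans_Phi s k (Suc j) ** dyn_B s j else 0)"

definition big_C ::
    "('x::finite, 'u::finite, 'y::finite, 'h::finite, 'd::finite, 'g::finite,
      'm::{finite,linorder}) steering_data \<Rightarrow> real^('m \<times> 'x)" where
  "big_C s = stack (\<lambda>k. \<Sum>j<k. trans_Phi s k (Suc j) *v dyn_c s j)"

definition big_L ::
    "('x::finite, 'u::finite, 'y::finite, 'h::finite, 'd::finite, 'g::finite,
      'm::{finite,linorder}) steering_data \<Rightarrow>
     real^('m \<times> 'y)^('m \<times> 'x)" where
  "big_L s = block_mat (\<lambda>k j. if j \<le> k then trans_Phi s k j ** gain_L s j else 0)"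

definition S_half ::
    "('x::finite, 'u::finite, 'y::finite, 'h::finite, 'd::finite, 'g::finite,
      'm::{finite,linorder}) steering_data \<Rightarrow>
     real^('x + 'm \<times> 'y)^('m \<times> 'x)" where
  "S_half s = hcat (big_A s ** P0_hat_half s) (big_L s ** P_Y_half s)"

text \<open>
  The type \<open>'n\<close> (of cardinality \<open>N\<close>) indexes the control times \<open>0, \<dots>, N - 1\<close>.  If \<open>'m\<close> has one
  element more than \<open>'n\<close>, then \<open>blkdiag Ks\<close> below has a zero last block column.
\<close>

type_synonym ('n, 'm, 'x, 'u) decision =
  "(real^('n \<times> 'u)) \<times> (real^('m \<times> 'x)^('n \<times> 'u)) \<times> (real^'m)"

type_synonym ('n, 'm, 'x, 'u) program =
  "(('n, 'm, 'x, 'u) decision, real^'x) opt_problem"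

definition gain_space ::
    "(real^('m::{finite,linorder} \<times> 'x::finite)^('n::{finite,linorder} \<times> 'u::finite)) set" where
  "gain_space = range (\<lambda>Ks :: nat \<Rightarrow> real^'x^'u. blkdiag Ks)"

definition x_bar ::
    "('x::finite, 'u::finite, 'y::finite, 'h::finite, 'd::finite, 'g::finite,
      'm::{finite,linorder}) steering_data \<Rightarrow>
     real^('n::{finite,linorder} \<times> 'u) \<Rightarrow> nat \<Rightarrow> real^'x" where
  "x_bar s U k = block_of k *v (big_A s *v x0_bar s + big_B s *v U + big_C s)"

definition u_bar :: "real^('n::{finite,linorder} \<times> 'u) \<Rightarrow> nat \<Rightarrow> real^'u" where
  "u_bar U k = block_of k *v U"

definition X_half ::
    "('x::finite, 'u::finite, 'y::finite, 'h::finite, 'd::finite, 'g::finite,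
      'm::{finite,linorder}) steering_data \<Rightarrow>
     real^('m \<times> 'x)^('n::{finite,linorder} \<times> 'u) \<Rightarrow> nat \<Rightarrow> real^('x + 'm \<times> 'y)^'x" where
  "X_half s K k = block_of k ** (mat 1 + big_B s ** K) ** S_half s"

definition P_half ::
    "('x::finite, 'u::finite, 'y::finite, 'h::finite, 'd::finite, 'g::finite,
      'm::{finite,linorder}) steering_data \<Rightarrow>
     real^('m \<times> 'x)^('n::{finite,linorder} \<times> 'u) \<Rightarrow> nat \<Rightarrow>
     real^(('x + 'm \<times> 'y) + 'x)^'x" where
  "P_half s K k = hcat (X_half s K k) (P_tilde_half s k)"

definition Pu_half ::
    "('x::finite, 'u::finite, 'y::finite, 'h::finite, 'd::finite, 'g::finite,
      'm::{finite,linorder}) steering_data \<Rightarrow>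
     real^('m \<times> 'x)^('n::{finite,linorder} \<times> 'u) \<Rightarrow> nat \<Rightarrow> real^('x + 'm \<times> 'y)^'u" where
  "Pu_half s K k = block_of k ** K ** S_half s"

datatype control_mode = Impulsive | Continuous

definition J_ub ::
    "control_mode \<Rightarrow> ('x::finite, 'u::finite, 'y::finite, 'h::finite, 'd::finite, 'g::finite,
      'm::{finite,linorder}) steering_data \<Rightarrow>
     real^('n::{finite,linorder} \<times> 'u) \<Rightarrow> real^('m \<times> 'x)^('n \<times> 'u) \<Rightarrow> real" where
  "J_ub mode s U K =
     (\<Sum>k<horizon s.
        (norm (u_bar U k) + m_chi2 0.01 CARD('u) * spectral_norm (Pu_half s K k))
          * (case mode of Impulsive \<Rightarrow> 1 | Continuous \<Rightarrow> dt s k))"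

definition J_penalty ::
    "control_mode \<Rightarrow> ('x::finite, 'u::finite, 'y::finite, 'h::finite, 'd::finite, 'g::finite,
      'm::{finite,linorder}) steering_data \<Rightarrow>
     ('n::{finite,linorder}, 'm, 'x, 'u) decision \<Rightarrow> real" where
  "J_penalty mode s = (\<lambda>(U, K, \<zeta>). J_ub mode s U K + weight s * (\<Sum>k\<in>UNIV. \<bar>\<zeta> $ k\<bar>))"

text \<open>
  Constraints: an inequality \<open>lhs \<le> rhs\<close> is represented by the function \<open>lhs - rhs\<close>.
\<close>

definition con_halfspace ::
    "('x::finite, 'u::finite, 'y::finite, 'h::finite, 'd::finite, 'g::finite,
      'm::{finite,linorder}) steering_data \<Rightarrow> nat \<Rightarrow> nat \<Rightarrow>
     ('n::{finite,linorder}, 'm, 'x, 'u) decision \<Rightarrow> real" where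
  "con_halfspace s j k = (\<lambda>(U, K, \<zeta>).
     con_a s j \<bullet> x_bar s U k + con_b s j
       + m_normal (eps_con s j) * norm (con_a s j v* P_half s K k))"

definition con_ball ::
    "('x::finite, 'u::finite, 'y::finite, 'h::finite, 'd::finite, 'g::finite,
      'm::{finite,linorder}) steering_data \<Rightarrow> nat \<Rightarrow>
     ('n::{finite,linorder}, 'm, 'x, 'u) decision \<Rightarrow> real" where
  "con_ball s k = (\<lambda>(U, K, \<zeta>).
     norm (mat_H s *v (x_bar s U k - x_ref s k))
       + m_chi2 (eps_x s) CARD('h) * spectral_norm (mat_H s ** P_half s K k) - d_max s)"

definition con_control ::
    "('x::finite, 'u::finite, 'y::finite, 'h::finite, 'd::finite, 'g::finite,
      'm::{finite,linorder}) steering_data \<Rightarrow> nat \<Rightarrow>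
     ('n::{finite,linorder}, 'm, 'x, 'u) decision \<Rightarrow> real" where
  "con_control s k = (\<lambda>(U, K, \<zeta>).
     norm (u_bar U k) + m_chi2 (eps_u s) CARD('u) * spectral_norm (Pu_half s K k) - u_max s)"

definition con_rate ::
    "('x::finite, 'u::finite, 'y::finite, 'h::finite, 'd::finite, 'g::finite,
      'm::{finite,linorder}) steering_data \<Rightarrow> nat \<Rightarrow>
     ('n::{finite,linorder}, 'm, 'x, 'u) decision \<Rightarrow> real" where
  "con_rate s k = (\<lambda>(U, K, \<zeta>).
     norm ((block_of (k + 1) - block_of k) *v U)
       + m_chi2 (eps_u s) CARD('u)
           * spectral_norm ((block_of (k + 1) - block_of k) ** K ** S_half s) - du_max s)"

definition con_final_mean ::
    "('x::finite, 'u::finite, 'y::finite, 'h::finite, 'd::finite, 'g::finite,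
      'm::{finite,linorder}) steering_data \<Rightarrow>
     ('n::{finite,linorder}, 'm, 'x, 'u) decision \<Rightarrow> real^'x" where
  "con_final_mean s = (\<lambda>(U, K, \<zeta>).
     block_of (horizon s) *v (big_A s *v x0_bar s + big_B s *v U + big_C s) - x_f s)"

definition con_final_cov ::
    "('x::finite, 'u::finite, 'y::finite, 'h::finite, 'd::finite, 'g::finite,
      'm::{finite,linorder}) steering_data \<Rightarrow>
     ('n::{finite,linorder}, 'm, 'x, 'u) decision \<Rightarrow> real" where
  "con_final_cov s = (\<lambda>(U, K, \<zeta>).
     spectral_norm (matrix_inv (P_gap_half s) ** block_of (horizon s)
       ** (mat 1 + big_B s ** K) ** S_half s) - 1)"

definition g_stc ::
    "('x::finite, 'u::finite, 'y::finite, 'h::finite, 'd::finite, 'g::finite,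
      'm::finite) steering_data \<Rightarrow> real^'x \<Rightarrow> real" where
  "g_stc s x = norm (H_r s *v x) - r_trigger s"

definition c_stc ::
    "('x::finite, 'u::finite, 'y::finite, 'h::finite, 'd::finite, 'g::finite,
      'm::finite) steering_data \<Rightarrow> real^'x \<Rightarrow> real^'q^'x \<Rightarrow> real" where
  "c_stc s x R =
     norm (A_cone s *v (H_r s *v x)) - b_cone s \<bullet> (H_r s *v x)
       + m_chi2 (eps_x s / 2) 2 * spectral_norm (A_cone s ** H_r s ** R)
       + m_normal (eps_x s / 2) * norm (b_cone s v* H_r s v* R)"

definition con_trigger ::
    "('x::finite, 'u::finite, 'y::finite, 'h::finite, 'd::finite, 'g::finite,
      'm::{finite,linorder}) steering_data \<Rightarrow> 'm \<Rightarrow>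
     ('n::{finite,linorder}, 'm, 'x, 'u) decision \<Rightarrow> real" where
  "con_trigger s i = (\<lambda>(U, K, \<zeta>).
     - min (g_stc s (xbar_ref s (blk i))) 0
         * c_stc s (x_bar s U (blk i)) (P_half s K (blk i)) - \<zeta> $ i)"

definition steering_problem ::
    "control_mode \<Rightarrow> ('x::finite, 'u::finite, 'y::finite, 'h::finite, 'd::finite, 'g::finite,
      'm::{finite,linorder}) steering_data \<Rightarrow>
     ('n::{finite,linorder}, 'm, 'x, 'u) program" where
  "steering_problem mode s = \<lparr>
     space_of = UNIV \<times> gain_space \<times> UNIV,
     objective = J_penalty mode s,
     ineqs =
       {con_halfspace s j k | j k. j < n_con s \<and> k \<le> horizon s} \<union>
       {con_ball s k | k. k \<le> horizon s} \<union>
       {con_control s k | k. k < horizon s} \<union>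
       {con_rate s k | k. k + 1 < horizon s} \<union>
       {con_final_cov s} \<union>
       range (con_trigger s),
     eqs = {con_final_mean s} \<rparr>"

end

theory Submission
  imports Defs
begin

text \<open>
  The variables enter the data of the problem only through affine maps: \<open>x_bar\<close> and \<open>u_bar\<close>
  are affine in the nominal control, while \<open>P_half\<close> and \<open>Pu_half\<close> are affine in the gain matrix.
  The latter is the reason for working with the factors \<open>P_half\<close> and \<open>Pu_half\<close> instead of the
  covariances, which are quadratic in the gain.  Hence every norm occurring in the problem, Euclidean
  or spectral, is a seminorm of an affine map and therefore convex, and the objective and the
  inequality constraints are sums of affine functions and of multiples of such norms.

  What remains to be checked is that no norm is multiplied by a negative number.  The multipliers that
  are not obviously nonnegative are the quantiles.  A chi-squared quantile is nonnegative because a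
  sum of squares is (\<open>m_chi2_nonneg\<close>).  A quantile of the standard normal distribution is
  nonnegative only for levels of at least one half, by symmetry (\<open>m_normal_nonneg\<close>).  The
  risk levels meet this condition because \<open>eps_x s < 1/2\<close>; the individual risks inherit the bound because they are positive
  and their sum is at most \<open>eps_x s\<close>.  The trigger factor \<open>- min (g_stc s x) 0\<close>
  is nonnegative and, being evaluated at a reference state, constant.
\<close>

section \<open>Sign of the quantiles\<close>

text \<open>
  The hypothesis \<open>p < 1\<close> keeps the set of the infimum nonempty; the infimum of the empty set of
  reals is an unspecified number, which might be negative.
\<close>

lemma quantile_nonneg:
  assumes "real_distribution M" and "p < 1"
    and neg: "\<And>x. x < 0 \<Longrightarrow> cdf M x < p"
  shows "0 \<le> quantile M p"
  unfolding quantile_def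
proof (rule cInf_greatest)
  interpret real_distribution M by fact
  have "eventually (\<lambda>x. p < cdf M x) at_top"
    using order_tendstoD(1)[OF cdf_lim_at_top_prob \<open>p < 1\<close>] .
  then obtain x where "p < cdf M x"
    by (meson eventually_at_top_linorder order_refl)
  then show "{x. p \<le> cdf M x} \<noteq> {}"
    by (auto intro: less_imp_le)
  show "0 \<le> x" if "x \<in> {x. p \<le> cdf M x}" for x
    using that neg[of x] by force
qed

text \<open>
  The reflection at the origin preserves the normal density, so the half-lines below \<open>x\<close> and above
  \<open>- x\<close> have equal mass; they are disjoint for negative \<open>x\<close>.
\<close>

lemma std_normal_cdf_neg:
  assumes "x < 0"
  shows "cdf std_normal_distribution x \<le> 1/2"
proof -
  let ?M = std_normal_distribution
  interpret real_distribution ?M by (rule real_dist_normal_dist)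
  have "emeasure ?M {..x} = (\<integral>\<^sup>+ t. ennreal (std_normal_density t) * indicator {..x} t \<partial>lborel)"
    by (simp add: emeasure_density)
  also have "\<dots> = (\<integral>\<^sup>+ t. ennreal (std_normal_density (- t)) * indicator {..x} (- t) \<partial>lborel)"
    by (subst nn_integral_real_affine[where c = "-1" and t = 0]) auto
  also have "\<dots> = (\<integral>\<^sup>+ t. ennreal (std_normal_density t) * indicator {-x..} t \<partial>lborel)"
    by (intro nn_integral_cong) (auto simp: std_normal_density_def split: split_indicator)
  also have "\<dots> = emeasure ?M {-x..}"
    by (simp add: emeasure_density)
  finally have "prob {..x} = prob {-x..}"
    by (simp add: measure_def)
  moreover have "prob {..x} + prob {-x..} = prob ({..x} \<union> {-x..})"
    using assms by (intro finite_measure_Union[symmetric]) auto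
  moreover have "prob ({..x} \<union> {-x..}) \<le> 1"
    by (rule prob_le_1)
  ultimately have "2 * prob {..x} \<le> 1"
    by linarith
  then show ?thesis
    by (simp add: cdf_def)
qed

lemma m_normal_nonneg:
  assumes "0 < \<epsilon>" and "\<epsilon> < 1/2"
  shows "0 \<le> m_normal \<epsilon>"
  unfolding m_normal_def
proof (rule quantile_nonneg[OF real_dist_normal_dist])
  show "cdf std_normal_distribution x < 1 - \<epsilon>" if "x < 0" for x
    using std_normal_cdf_neg[OF that] assms by linarith
qed (use assms in simp)

lemma real_distribution_chi_squared: "real_distribution (chi_squared n)"
proof -
  interpret prob_space "Pi\<^sub>M {..<n} (\<lambda>_. std_normal_distribution)"
    using real_dist_normal_dist
    by (intro prob_space_PiM) (simp add: real_distribution_def)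
  show ?thesis
    unfolding chi_squared_def by (intro real_distribution_distr) measurable
qed

lemma chi_squared_cdf_neg:
  assumes "x < 0"
  shows "cdf (chi_squared n) x = 0"
proof -
  let ?P = "Pi\<^sub>M {..<n} (\<lambda>_. std_normal_distribution)"
  have "(\<Sum>i<n. (\<omega> i)\<^sup>2) > x" for \<omega> :: "nat \<Rightarrow> real"
    using assms by (meson less_le_trans sum_nonneg zero_le_power2)
  then have "(\<lambda>\<omega>. \<Sum>i<n. (\<omega> i)\<^sup>2) -` {..x} \<inter> space ?P = {}"
    by (auto simp: not_le[symmetric])
  moreover have "(\<lambda>\<omega>. \<Sum>i<n. (\<omega> i)\<^sup>2) \<in> borel_measurable ?P"
    by measurable
  ultimately show ?thesis
    by (simp add: cdf_def chi_squared_def measure_distr)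
qed

lemma m_chi2_nonneg:
  assumes "0 < \<epsilon>" and "\<epsilon> < 1"
  shows "0 \<le> m_chi2 \<epsilon> n"
  unfolding m_chi2_def
  using assms
  by (intro real_sqrt_ge_zero quantile_nonneg real_distribution_chi_squared)
    (auto simp: chi_squared_cdf_neg)

section \<open>Affine maps\<close>

lemma affine_map_on_linear_comp:
  assumes "linear f" and "affine_map_on X h"
  shows "affine_map_on X (\<lambda>v. f (h v))"
proof -
  obtain l c where "linear l" and h: "\<forall>v\<in>X. h v = l v + c"
    using assms(2) unfolding affine_map_on_def by blast
  have "linear (f \<circ> l)"
    using \<open>linear l\<close> assms(1) by (rule linear_compose)
  moreover have "\<forall>v\<in>X. f (h v) = (f \<circ> l) v + f c"
    using h by (simp add: linear_add[OF assms(1)])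
  ultimately show ?thesis
    unfolding affine_map_on_def by blast
qed

lemma affine_map_on_linear: "linear f \<Longrightarrow> affine_map_on X f"
  unfolding affine_map_on_def by (intro exI[of _ f] exI[of _ 0]) simp

lemma affine_map_on_const: "affine_map_on X (\<lambda>v. c)"
  unfolding affine_map_on_def by (intro exI[of _ "\<lambda>_. 0"] exI[of _ c]) (simp add: linear_zero)

lemma affine_map_on_add:
  assumes "affine_map_on X f" and "affine_map_on X g"
  shows "affine_map_on X (\<lambda>v. f v + g v)"
proof -
  obtain l c m d where "linear l" "linear m"
    and f: "\<forall>v\<in>X. f v = l v + c" and g: "\<forall>v\<in>X. g v = m v + d"
    using assms unfolding affine_map_on_def by blast
  have "linear (\<lambda>v. l v + m v)"
    using \<open>linear l\<close> \<open>linear m\<close> by (rule linear_compose_add)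
  moreover have "\<forall>v\<in>X. f v + g v = (l v + m v) + (c + d)"
    using f g by simp
  ultimately show ?thesis
    unfolding affine_map_on_def by blast
qed

lemma affine_map_on_diff_const:
  "affine_map_on X f \<Longrightarrow> affine_map_on X (\<lambda>v. f v - c)"
  using affine_map_on_add[of X f "\<lambda>_. - c"] by (simp add: affine_map_on_const)

lemma linear_matrix_mult_left: "linear (\<lambda>M :: real^'b^'c. A ** M)"
  by (rule linearI)
    (simp_all add: vec_eq_iff matrix_matrix_mult_def sum.distrib sum_distrib_left algebra_simps)

lemma linear_matrix_mult_right: "linear (\<lambda>M :: real^'b^'c. M ** A)"
  by (rule linearI)
    (simp_all add: vec_eq_iff matrix_matrix_mult_def sum.distrib sum_distrib_left algebra_simps)

lemma linear_vector_matrix_mult: "linear (\<lambda>M :: real^'b^'c. a v* M)"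
  by (rule linearI)
    (simp_all add: vec_eq_iff vector_matrix_mult_def sum.distrib sum_distrib_left algebra_simps)

lemma affine_map_on_hcat:
  assumes "affine_map_on X F"
  shows "affine_map_on X (\<lambda>v. hcat (F v) R)"
proof -
  \<comment> \<open>the map that appends the fixed block \<open>R\<close> is not linear but affine: split off its constant part\<close>
  have "linear (\<lambda>M. hcat M (0 :: real^'d^'c))"
    by (rule linearI) (auto simp: hcat_def vec_eq_iff split: sum.split)
  then have "affine_map_on X (\<lambda>v. hcat (F v) 0 + hcat 0 R)"
    by (intro affine_map_on_add affine_map_on_const affine_map_on_linear_comp[OF _ assms])
  moreover have "hcat (F v) 0 + hcat 0 R = hcat (F v) R" for v
    by (auto simp: hcat_def vec_eq_iff split: sum.split)
  ultimately show ?thesis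
    by simp
qed

section \<open>Convex functions\<close>

lemma convex_on_affine_comp:
  assumes "convex_on UNIV f" and "affine_map_on UNIV h"
  shows "convex_on UNIV (\<lambda>v. f (h v))"
proof (rule convex_onI)
  obtain l c where "linear l" and h: "\<And>v. h v = l v + c"
    using assms(2) unfolding affine_map_on_def by blast
  fix t :: real and x y
  assume t: "0 < t" "t < 1"
  have "l ((1 - t) *\<^sub>R x + t *\<^sub>R y) = (1 - t) *\<^sub>R l x + t *\<^sub>R l y"
    by (simp add: linear_add[OF \<open>linear l\<close>] linear_scale[OF \<open>linear l\<close>])
  then have "h ((1 - t) *\<^sub>R x + t *\<^sub>R y) = (1 - t) *\<^sub>R h x + t *\<^sub>R h y"
    by (simp add: h algebra_simps)
  then show "f (h ((1 - t) *\<^sub>R x + t *\<^sub>R y)) \<le> (1 - t) * f (h x) + t * f (h y)"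
    using convex_onD[OF assms(1), of t "h x" "h y"] t by simp
qed simp

lemma convex_on_affine:
  "affine_map_on UNIV h \<Longrightarrow> convex_on UNIV (h :: _ \<Rightarrow> real)"
  by (rule convex_on_affine_comp[of "\<lambda>x. x"]) (simp_all add: convex_on_ident)

lemma convex_on_norm_affine:
  fixes h :: "'v::real_vector \<Rightarrow> 'e::real_normed_vector"
  assumes "affine_map_on UNIV h"
  shows "convex_on UNIV (\<lambda>v. norm (h v))"
  using convex_on_affine_comp[OF convex_on_dist[OF convex_UNIV, of 0] assms] by simp

lemma convex_on_spectral_norm: "convex_on UNIV (spectral_norm :: real^'b^'c \<Rightarrow> real)"
proof (rule convex_onI)
  fix t :: real and M M' :: "real^'b^'c"
  assume t: "0 < t" "t < 1"
  have bl: "bounded_linear (\<lambda>v. A *v v)" for A :: "real^'b^'c"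
    by (rule matrix_vector_mul_bounded_linear)
  have "((1 - t) *\<^sub>R M + t *\<^sub>R M') *v v = (1 - t) *\<^sub>R (M *v v) + t *\<^sub>R (M' *v v)" for v
    by (simp add: vec_eq_iff matrix_vector_mult_def sum.distrib sum_distrib_left distrib_right
        mult.assoc)
  then have "spectral_norm ((1 - t) *\<^sub>R M + t *\<^sub>R M')
      = onorm (\<lambda>v. (1 - t) *\<^sub>R (M *v v) + t *\<^sub>R (M' *v v))"
    by (simp only: spectral_norm_def)
  also have "\<dots> \<le> onorm (\<lambda>v. (1 - t) *\<^sub>R (M *v v)) + onorm (\<lambda>v. t *\<^sub>R (M' *v v))"
    by (intro onorm_triangle bounded_linear_const_scaleR bl)
  also have "\<dots> = (1 - t) * spectral_norm M + t * spectral_norm M'"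
    using t by (simp add: onorm_scaleR[OF bl] spectral_norm_def)
  finally show "spectral_norm ((1 - t) *\<^sub>R M + t *\<^sub>R M')
      \<le> (1 - t) * spectral_norm M + t * spectral_norm M'" .
qed simp

lemmas convex_on_spectral_norm_affine = convex_on_affine_comp[OF convex_on_spectral_norm]

lemma convex_on_finite_sum:
  assumes "finite I" and "convex X" and "\<And>i. i \<in> I \<Longrightarrow> convex_on X (f i)"
  shows "convex_on X (\<lambda>v. \<Sum>i\<in>I. f i v)"
  using assms(1,3)
  by (induction I rule: finite_induct) (auto simp: convex_on_const \<open>convex X\<close> intro!: convex_on_add)

lemma convex_on_diff_affine:
  assumes "convex_on UNIV f" and "affine_map_on UNIV (h :: _ \<Rightarrow> real)"
  shows "convex_on UNIV (\<lambda>v. f v - h v)"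
  using convex_on_add[OF assms(1) convex_on_affine[OF
      affine_map_on_linear_comp[OF linear_uminus assms(2)]]]
  by simp

section \<open>The steering problem\<close>

lemma affine_nominal_control:
  "affine_map_on X (\<lambda>v :: ('n::finite, 'm::finite, 'x::finite, 'u::finite) decision.
     fst v)"
  by (rule affine_map_on_linear[OF linear_fst])

lemma affine_gain:
  "affine_map_on X (\<lambda>v :: ('n::finite, 'm::finite, 'x::finite, 'u::finite) decision.
     fst (snd v))"
  by (rule affine_map_on_linear_comp[OF linear_fst affine_map_on_linear[OF linear_snd]])

lemma affine_slack:
  "affine_map_on X (\<lambda>v :: ('n::finite, 'm::finite, 'x::finite, 'u::finite) decision.
     snd (snd v) $ i)"
  by (intro affine_map_on_linear_comp[OF bounded_linear.linear[OF bounded_linear_vec_nth]]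
      affine_map_on_linear_comp[OF linear_snd] affine_map_on_linear linear_snd)

lemmas affine_intros =
  affine_nominal_control affine_gain affine_slack affine_map_on_const affine_map_on_add
  affine_map_on_diff_const affine_map_on_hcat
  affine_map_on_linear_comp[OF matrix_vector_mul_linear]
  affine_map_on_linear_comp[OF linear_matrix_mult_left]
  affine_map_on_linear_comp[OF linear_matrix_mult_right]
  affine_map_on_linear_comp[OF linear_vector_matrix_mult]
  affine_map_on_linear_comp[OF bounded_linear.linear[OF bounded_linear_inner_right]]

lemma affine_x_bar:
  "affine_map_on X (\<lambda>v :: ('n::{finite,linorder}, 'm::{finite,linorder}, 'x::finite, 'u::finite)
     decision. x_bar s (fst v) k)"
  unfolding x_bar_def by (intro affine_intros)

lemma affine_u_bar:
  "affine_map_on X (\<lambda>v :: ('n::{finite,linorder}, 'm::{finite,linorder}, 'x::finite, 'u::finite)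
     decision. u_bar (fst v) k)"
  unfolding u_bar_def by (intro affine_intros)

lemma affine_P_half:
  "affine_map_on X (\<lambda>v :: ('n::{finite,linorder}, 'm::{finite,linorder}, 'x::finite, 'u::finite)
     decision. P_half s (fst (snd v)) k)"
  unfolding P_half_def X_half_def by (intro affine_intros)

lemma affine_Pu_half:
  "affine_map_on X (\<lambda>v :: ('n::{finite,linorder}, 'm::{finite,linorder}, 'x::finite, 'u::finite)
     decision. Pu_half s (fst (snd v)) k)"
  unfolding Pu_half_def by (intro affine_intros)

lemmas steering_affine = affine_x_bar affine_u_bar affine_P_half affine_Pu_half affine_intros

lemmas steering_convex =
  convex_on_add convex_on_diff_affine convex_on_cmul convex_on_norm_affine
  convex_on_spectral_norm_affine

lemma subspace_gain_space: "subspace gain_space"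
proof (rule subspaceI)
  show "0 \<in> gain_space"
    unfolding gain_space_def
    by (rule image_eqI[of _ _ "\<lambda>_. 0"]) (simp_all add: blkdiag_def block_mat_def vec_eq_iff)
next
  fix K K' :: "real^('a \<times> 'b)^('c \<times> 'd)"
  assume "K \<in> gain_space" "K' \<in> gain_space"
  then obtain Ks Ks' where "K = blkdiag Ks" "K' = blkdiag Ks'"
    by (auto simp: gain_space_def)
  then have "K + K' = blkdiag (\<lambda>k. Ks k + Ks' k)"
    by (simp add: blkdiag_def block_mat_def vec_eq_iff)
  then show "K + K' \<in> gain_space"
    unfolding gain_space_def by blast
next
  fix r :: real and K :: "real^('a \<times> 'b)^('c \<times> 'd)"
  assume "K \<in> gain_space"
  then obtain Ks where "K = blkdiag Ks"
    by (auto simp: gain_space_def)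
  then have "r *\<^sub>R K = blkdiag (\<lambda>k. r *\<^sub>R Ks k)"
    by (simp add: blkdiag_def block_mat_def vec_eq_iff)
  then show "r *\<^sub>R K \<in> gain_space"
    unfolding gain_space_def by blast
qed

lemma convex_J_penalty:
  assumes "\<forall>k<horizon s. 0 < dt s k" and "0 < weight s"
  shows "convex_on UNIV (J_penalty mode s ::
    ('n::{finite,linorder}, 'm::{finite,linorder}, 'x::finite, 'u::finite) decision \<Rightarrow> real)"
proof -
  have stage: "convex_on UNIV (\<lambda>v :: ('n, 'm, 'x, 'u) decision.
      (norm (u_bar (fst v) k) + m_chi2 0.01 CARD('u) * spectral_norm (Pu_half s (fst (snd v)) k))
        * (case mode of Impulsive \<Rightarrow> 1 | Continuous \<Rightarrow> dt s k))" if "k < horizon s" for k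
  proof -
    have "0 \<le> (case mode of Impulsive \<Rightarrow> 1 | Continuous \<Rightarrow> dt s k)"
      using assms(1) that by (simp split: control_mode.split add: less_imp_le)
    then show ?thesis
      by (subst mult.commute) (intro steering_convex steering_affine m_chi2_nonneg; simp)
  qed
  have "convex_on UNIV (\<lambda>v :: ('n, 'm, 'x, 'u) decision. \<Sum>k\<in>UNIV. norm (snd (snd v) $ k))"
    by (intro convex_on_finite_sum steering_convex steering_affine) simp_all
  then show ?thesis
    unfolding J_penalty_def J_ub_def case_prod_unfold
    using assms(2) stage by (intro convex_on_add convex_on_cmul convex_on_finite_sum[OF finite_lessThan])
      (auto simp: real_norm_def)
qed

text \<open>
  The cone constraint couples the mean state \<open>x\<close> with the factor \<open>R\<close> of the covariance only additively.
  The part in \<open>x\<close> is a norm minus a linear function; the part in \<open>R\<close> consists of norms of linear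
  images, whose multipliers are nonnegative because \<open>eps_x s / 2\<close> is below one half.
\<close>

lemma convex_c_stc:
  assumes "0 < eps_x s" and "eps_x s < 1/2"
    and "affine_map_on UNIV x" and "affine_map_on UNIV R"
  shows "convex_on UNIV (\<lambda>v. c_stc s (x v) (R v))"
  unfolding c_stc_def
  using assms
  by (intro steering_convex affine_intros assms(3,4) m_chi2_nonneg m_normal_nonneg) auto

text \<open>
  Convexity holds over arbitrary gain matrices and is inherited by the subspace \<open>gain_space\<close>, so
  that the block structure of the gain need not be carried through the compositions of affine maps.
\<close>

lemma convex_steering_constraints:
  fixes s :: "('x::finite, 'u::finite, 'y::finite, 'h::finite, 'd::finite, 'g::finite,
      'm::{finite,linorder}) steering_data"
  assumes "0 < eps_x s" "eps_x s < 1/2" and "0 < eps_u s" "eps_u s < 1"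
    and "\<forall>j<n_con s. 0 < eps_con s j" and "(\<Sum>j<n_con s. eps_con s j) \<le> eps_x s"
    and "g \<in> ineqs (steering_problem mode s :: ('n::{finite,linorder}, 'm, 'x, 'u) program)"
  shows "convex_on UNIV g"
proof -
  have halfspace: "convex_on UNIV (con_halfspace s j k :: ('n, 'm, 'x, 'u) decision \<Rightarrow> real)"
    if "j < n_con s" for j k
  proof -
    \<comment> \<open>the risks are positive, so each of them is bounded by their sum\<close>
    have "eps_con s j \<le> (\<Sum>j<n_con s. eps_con s j)"
      using assms(5) that by (intro member_le_sum) (auto intro: less_imp_le)
    then have "0 \<le> m_normal (eps_con s j)"
      using assms that by (intro m_normal_nonneg) auto
    then show ?thesis
      unfolding con_halfspace_def case_prod_unfold
      by (intro steering_convex convex_on_affine steering_affine)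
  qed
  have ball: "convex_on UNIV (con_ball s k :: ('n, 'm, 'x, 'u) decision \<Rightarrow> real)" for k
    unfolding con_ball_def case_prod_unfold
    using assms(1,2) by (intro steering_convex steering_affine m_chi2_nonneg) auto
  have control: "convex_on UNIV (con_control s k :: ('n, 'm, 'x, 'u) decision \<Rightarrow> real)" for k
    unfolding con_control_def case_prod_unfold
    using assms(3,4) by (intro steering_convex steering_affine m_chi2_nonneg) auto
  have rate: "convex_on UNIV (con_rate s k :: ('n, 'm, 'x, 'u) decision \<Rightarrow> real)" for k
    unfolding con_rate_def case_prod_unfold
    using assms(3,4) by (intro steering_convex steering_affine m_chi2_nonneg) auto
  have final_cov: "convex_on UNIV (con_final_cov s :: ('n, 'm, 'x, 'u) decision \<Rightarrow> real)"
    unfolding con_final_cov_def case_prod_unfold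
    by (intro steering_convex steering_affine)
  have trigger: "convex_on UNIV (con_trigger s i :: ('n, 'm, 'x, 'u) decision \<Rightarrow> real)" for i
    unfolding con_trigger_def case_prod_unfold
    using assms(1,2) by (intro steering_convex convex_c_stc steering_affine) auto
  show ?thesis
    using assms(7) halfspace ball control rate final_cov trigger
    by (auto simp: steering_problem_def)
qed

lemma finite_steering_constraints: "finite (ineqs (steering_problem mode s))"
proof -
  have "finite {k. k + 1 < horizon s}"
    by (rule finite_subset[of _ "{..<horizon s}"]) auto
  then show ?thesis
    unfolding steering_problem_def
    by (simp add: finite_image_set finite_image_set2)
qed

lemma affine_con_final_mean: "affine_map_on X (con_final_mean s)"
  unfolding con_final_mean_def case_prod_unfold by (intro steering_affine)

theorem theorem2:
  fixes s :: "('x::{finite,linorder}, 'u::finite, 'y::{finite,linorder}, 'h::finite,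
      'd::finite, 'g::finite, 'm::{finite,linorder}) steering_data"
    and mode :: control_mode
  assumes "CARD('n::{finite,linorder}) = horizon s"
    and "CARD('m) = horizon s + 1"
    and "psd (P0_hat s)"
    and "psd (P0_tilde_minus s)"
    and "\<forall>k\<le>horizon s. invertible (P_innov s k)"
    and "0 < eps_x s" and "eps_x s < 1/2"
    and "0 < eps_u s" and "eps_u s < 1"
    and "\<forall>j<n_con s. 0 < eps_con s j"
    and "(\<Sum>j<n_con s. eps_con s j) \<le> eps_x s"
    and "0 < d_max s" and "0 < u_max s" and "0 < du_max s"
    and "\<forall>k<horizon s. 0 < dt s k"
    and "transpose (P_f s) = P_f s"
    and "pos_def (P_f s - P_tilde s (horizon s))"
    and "0 < r_trigger s"
    and "0 < weight s"
    and "lower_triangular_sqrt (<) (P0_hat s) (P0_hat_half s)"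
    and "\<forall>k\<le>horizon s. lower_triangular_sqrt (<) (P_tilde s k) (P_tilde_half s k)"
    and "lower_triangular_sqrt lex_less (P_Y s) (P_Y_half s)"
    and "lower_triangular_sqrt (<) (P_f s - P_tilde s (horizon s)) (P_gap_half s)"
  shows "convex_optimization_problem (steering_problem mode s :: ('n, 'm, 'x, 'u) program)"
proof -
  let ?p = "steering_problem mode s :: ('n, 'm, 'x, 'u) program"
  have space: "space_of ?p = UNIV \<times> gain_space \<times> UNIV"
    and objective: "objective ?p = J_penalty mode s"
    and eqs: "eqs ?p = {con_final_mean s}"
    by (simp_all add: steering_problem_def)
  have subspace: "subspace (space_of ?p)"
    unfolding space by (intro subspace_Times subspace_gain_space subspace_UNIV)
  have restrict: "convex_on (space_of ?p) f" if "convex_on UNIV f" for f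
    using convex_on_subset[OF that] subspace_imp_convex[OF subspace] by simp
  show ?thesis
    unfolding convex_optimization_problem_def objective eqs
    using assms
    by (auto intro!: subspace restrict convex_J_penalty convex_steering_constraints
        finite_steering_constraints affine_con_final_mean)
qed

end
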